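(* Each $\mathrm{ECD}(\theta)$ is equivalent to a $\mathrm{BA}(v,r,2;\theta)$: under the correspondence that assigns to a resolvable design $d$ (with $r$ replicates of $v$ treatments and block sizes $k_1,k_2$) the $v\times r$ array whose $(i,h)$ entry is $0$ if treatment $i$ lies in the block of size $k_1$ of replicate $h$ and $1$ otherwise, the designs $d$ that are $\mathrm{ECD}(\theta)$ correspond one-to-one to the arrays that are $\mathrm{BA}(v,r,2;\theta)$.
   Context: Let $k_1\ge k_2\ge 2$ be integers, $v=k_1+k_2$, and $2\le r\le v-1$. A resolvable design $d$ consists of $r$ replicates (labelled $1,\dots,r$), each replicate being a partition of a fixed set of $v$ treatments into two blocks, one of size $k_1$ and one of size $k_2$ (if $k_1=k_2$, one block of each replicate is designated as "the block of size $k_1$"). For $h\ne h'$, $\phi_{dhh'}$ is the number of treatments common to the blocks of size $k_1$ in replicates $h$ and $h'$. A design $d$ is an equal concurrence design $\mathrm{ECD}(\theta)$ if $\phi_{dhh'}=\theta$ for all $h\neq h'$. A (two-symbol, strength two) balanced array $\mathrm{BA}(v,m,2;\theta)$, with $k_1$ zeros specified per column, is a $v\times m$ array on the symbols $0,1$ in which each column contains exactly $k_1$ zeros and there are constants $\mu_0=\theta,\mu_1,\mu_2$ such that, for any two distinct columns, among the $v$ pairs formed by the rows the pairs $(0,0),(0,1),(1,0),(1,1)$ occur with frequencies $\mu_0,\mu_1,\mu_1,\mu_2$ respectively. *)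

theory Defs
  imports Main "HOL-Library.FuncSet"
begin

text \<open>
  A replicate is an ordered pair of blocks whose first component is the block of size \<open>k1\<close>.
  For \<open>k1 \<noteq> k2\<close> the order is determined by the block sizes; for \<open>k1 = k2\<close> it records which
  of the two blocks is designated as the block of size \<open>k1\<close>.
\<close>

definition replicates :: "'a set \<Rightarrow> nat \<Rightarrow> nat \<Rightarrow> ('a set \<times> 'a set) set" where
  "replicates T k1 k2 =
     {(A, B). A \<union> B = T \<and> A \<inter> B = {} \<and> card A = k1 \<and> card B = k2}"

text \<open>
  Designs and arrays are extensional functions, so that equality of two of them means
  agreement on the actual replicates and entries.
\<close>

definition resolvable_designs ::
    "'a set \<Rightarrow> nat \<Rightarrow> nat \<Rightarrow> nat \<Rightarrow> (nat \<Rightarrow> 'a set \<times> 'a set) set" where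
  "resolvable_designs T k1 k2 r = {1..r} \<rightarrow>\<^sub>E replicates T k1 k2"

definition concurrence :: "(nat \<Rightarrow> 'a set \<times> 'a set) \<Rightarrow> nat \<Rightarrow> nat \<Rightarrow> nat" where
  "concurrence d h h' = card (fst (d h) \<inter> fst (d h'))"

definition equal_concurrence :: "nat \<Rightarrow> nat \<Rightarrow> (nat \<Rightarrow> 'a set \<times> 'a set) \<Rightarrow> bool" where
  "equal_concurrence r \<theta> d \<longleftrightarrow>
     (\<forall>h\<in>{1..r}. \<forall>h'\<in>{1..r}. h \<noteq> h' \<longrightarrow> concurrence d h h' = \<theta>)"

text \<open>The rows of an array are indexed by \<open>T\<close>, its columns by \<open>{1..m}\<close>.\<close>

definition binary_arrays :: "'a set \<Rightarrow> nat \<Rightarrow> ('a \<Rightarrow> nat \<Rightarrow> nat) set" where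
  "binary_arrays T m = T \<rightarrow>\<^sub>E ({1..m} \<rightarrow>\<^sub>E {0, 1})"

definition pair_frequency ::
    "'a set \<Rightarrow> ('a \<Rightarrow> nat \<Rightarrow> nat) \<Rightarrow> nat \<Rightarrow> nat \<Rightarrow> nat \<times> nat \<Rightarrow> nat" where
  "pair_frequency T X h h' p = card {i \<in> T. (X i h, X i h') = p}"

definition balanced_array ::
    "'a set \<Rightarrow> nat \<Rightarrow> nat \<Rightarrow> nat \<Rightarrow> ('a \<Rightarrow> nat \<Rightarrow> nat) \<Rightarrow> bool" where
  "balanced_array T k1 m \<theta> X \<longleftrightarrow>
     X \<in> binary_arrays T m \<and>
     (\<forall>h\<in>{1..m}. card {i \<in> T. X i h = 0} = k1) \<and>
     (\<exists>\<mu>0 \<mu>1 \<mu>2. \<mu>0 = \<theta> \<and>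
        (\<forall>h\<in>{1..m}. \<forall>h'\<in>{1..m}. h \<noteq> h' \<longrightarrow>
           pair_frequency T X h h' (0, 0) = \<mu>0 \<and>
           pair_frequency T X h h' (0, 1) = \<mu>1 \<and>
           pair_frequency T X h h' (1, 0) = \<mu>1 \<and>
           pair_frequency T X h h' (1, 1) = \<mu>2))"

definition design_array ::
    "'a set \<Rightarrow> nat \<Rightarrow> (nat \<Rightarrow> 'a set \<times> 'a set) \<Rightarrow> 'a \<Rightarrow> nat \<Rightarrow> nat" where
  "design_array T r d = (\<lambda>i\<in>T. \<lambda>h\<in>{1..r}. if i \<in> fst (d h) then 0 else 1)"

end

theory Submission
  imports Defs
begin

text \<open>
  A column of a \<open>0\<close>-\<open>1\<close> array is the same thing as its set of zeros, and a replicate is the same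
  thing as its first block, since the second block is the complement in \<open>T\<close>. Reading the first
  block of replicate \<open>h\<close> as the zero set of column \<open>h\<close> therefore matches the designs with the
  arrays having \<open>k1\<close> zeros in each column (\<open>bij_betw_design_array\<close>), and the concurrence of two
  replicates becomes the frequency of the pair \<open>(0, 0)\<close> in two columns
  (\<open>pair_frequency_design_array\<close>).

  Balance asks for more than a constant frequency of \<open>(0, 0)\<close>, but the rest is automatic: once
  two columns both have \<open>k1\<close> zeros, inclusion and exclusion express the other three frequencies
  through the size of the intersection of the two zero sets (\<open>balanced_array_iff\<close>).
\<close>

definition column_zeros :: "'a set \<Rightarrow> ('a \<Rightarrow> nat \<Rightarrow> nat) \<Rightarrow> nat \<Rightarrow> 'a set" where
  "column_zeros T X h = {i \<in> T. X i h = 0}"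

lemma column_zeros_subset: "column_zeros T X h \<subseteq> T"
  by (auto simp: column_zeros_def)

lemma binary_array_entry:
  assumes "X \<in> binary_arrays T m" "i \<in> T" "h \<in> {1..m}"
  shows "X i h = 0 \<or> X i h = 1"
proof -
  have "X i \<in> {1..m} \<rightarrow>\<^sub>E {0, 1}"
    using assms(1,2) unfolding binary_arrays_def by (rule PiE_mem)
  then have "X i h \<in> {0, 1}"
    using assms(3) by (rule PiE_mem)
  then show ?thesis by simp
qed

lemma pair_frequency_00:
  "pair_frequency T X h h' (0, 0) = card (column_zeros T X h \<inter> column_zeros T X h')"
  unfolding pair_frequency_def column_zeros_def by (rule arg_cong[of _ _ card]) auto

lemma pair_frequency_by_zeros:
  assumes X: "X \<in> binary_arrays T m" and h: "h \<in> {1..m}" and h': "h' \<in> {1..m}"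
  shows "pair_frequency T X h h' (0, 1) = card (column_zeros T X h - column_zeros T X h')"
    and "pair_frequency T X h h' (1, 0) = card (column_zeros T X h' - column_zeros T X h)"
    and "pair_frequency T X h h' (1, 1) = card (T - (column_zeros T X h \<union> column_zeros T X h'))"
  unfolding pair_frequency_def column_zeros_def
  using binary_array_entry[OF X _ h] binary_array_entry[OF X _ h']
  by (fastforce intro!: arg_cong[of _ _ card])+

text \<open>
  Equal column sizes are what makes the frequencies of \<open>(0, 1)\<close> and \<open>(1, 0)\<close> agree: both
  are \<open>k1 - \<theta>\<close>. What remains for \<open>(1, 1)\<close> is \<open>card T - (2 * k1 - \<theta>)\<close>.
\<close>

lemma balanced_array_iff:
  assumes T: "finite T"
  shows "balanced_array T k1 m \<theta> X \<longleftrightarrow>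
    X \<in> binary_arrays T m \<and> (\<forall>h\<in>{1..m}. card (column_zeros T X h) = k1) \<and>
    (\<forall>h\<in>{1..m}. \<forall>h'\<in>{1..m}. h \<noteq> h' \<longrightarrow> pair_frequency T X h h' (0, 0) = \<theta>)"
    (is "_ \<longleftrightarrow> ?R")
proof
  assume "balanced_array T k1 m \<theta> X"
  then show ?R
    unfolding balanced_array_def column_zeros_def by blast
next
  assume R: ?R
  then have X: "X \<in> binary_arrays T m" by blast
  have "pair_frequency T X h h' (0, 1) = k1 - \<theta> \<and>
        pair_frequency T X h h' (1, 0) = k1 - \<theta> \<and>
        pair_frequency T X h h' (1, 1) = card T - (2 * k1 - \<theta>)"
    if h: "h \<in> {1..m}" and h': "h' \<in> {1..m}" and "h \<noteq> h'" for h h'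
  proof -
    let ?Z = "column_zeros T X h" and ?Z' = "column_zeros T X h'"
    have fin: "finite ?Z" "finite ?Z'"
      using T column_zeros_subset finite_subset by metis+
    have size: "card ?Z = k1" "card ?Z' = k1" "card (?Z \<inter> ?Z') = \<theta>"
      using R that by (auto simp: pair_frequency_00)
    have "card (?Z - ?Z') = k1 - \<theta>"
      using card_Diff_subset_Int[of ?Z ?Z'] fin size by simp
    moreover have "card (?Z' - ?Z) = k1 - \<theta>"
      using card_Diff_subset_Int[of ?Z' ?Z] fin size by (simp add: Int_commute)
    moreover have "card (?Z \<union> ?Z') = 2 * k1 - \<theta>"
      using card_Un_Int[OF fin] size by simp
    then have "card (T - (?Z \<union> ?Z')) = card T - (2 * k1 - \<theta>)"
      using card_Diff_subset[of "?Z \<union> ?Z'" T] fin column_zeros_subset[of T X] by simp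
    ultimately show ?thesis
      unfolding pair_frequency_by_zeros[OF X h h'] by blast
  qed
  then show "balanced_array T k1 m \<theta> X"
    using R unfolding balanced_array_def column_zeros_def by blast
qed

lemma replicates_eq:
  assumes "finite T" "card T = k1 + k2"
  shows "replicates T k1 k2 = (\<lambda>A. (A, T - A)) ` {A. A \<subseteq> T \<and> card A = k1}"
  using assms
  by (auto simp: replicates_def image_iff card_Diff_subset finite_subset)

lemma resolvable_design_replicate:
  assumes "finite T" "card T = k1 + k2" "d \<in> resolvable_designs T k1 k2 r" "h \<in> {1..r}"
  shows "fst (d h) \<subseteq> T" "card (fst (d h)) = k1" "d h = (fst (d h), T - fst (d h))"
proof -
  have "d h \<in> replicates T k1 k2"
    using assms(3,4) unfolding resolvable_designs_def by (rule PiE_mem)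
  then show "fst (d h) \<subseteq> T" "card (fst (d h)) = k1" "d h = (fst (d h), T - fst (d h))"
    using replicates_eq[OF assms(1,2)] by auto
qed

lemma column_zeros_design_array:
  assumes "finite T" "card T = k1 + k2" "d \<in> resolvable_designs T k1 k2 r" "h \<in> {1..r}"
  shows "column_zeros T (design_array T r d) h = fst (d h)"
  using resolvable_design_replicate(1)[OF assms] assms(4)
  by (auto simp: column_zeros_def design_array_def split: if_splits)

lemma pair_frequency_design_array:
  assumes "finite T" "card T = k1 + k2" "d \<in> resolvable_designs T k1 k2 r"
    and "h \<in> {1..r}" "h' \<in> {1..r}"
  shows "pair_frequency T (design_array T r d) h h' (0, 0) = concurrence d h h'"
  using column_zeros_design_array[OF assms(1-3)] assms(4,5)
  by (simp add: pair_frequency_00 concurrence_def)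

lemma design_array_binary: "design_array T r d \<in> binary_arrays T r"
  by (auto simp: design_array_def binary_arrays_def)

lemma bij_betw_design_array:
  assumes T: "finite T" "card T = k1 + k2"
  shows "bij_betw (design_array T r) (resolvable_designs T k1 k2 r)
    {X \<in> binary_arrays T r. \<forall>h\<in>{1..r}. card (column_zeros T X h) = k1}"
    (is "bij_betw _ ?D ?A")
proof (rule bij_betw_imageI)
  show "inj_on (design_array T r) ?D"
  proof (rule inj_onI)
    fix d e assume d: "d \<in> ?D" and e: "e \<in> ?D" and eq: "design_array T r d = design_array T r e"
    have "d h = e h" if h: "h \<in> {1..r}" for h
    proof -
      have "fst (d h) = fst (e h)"
        using column_zeros_design_array[OF T d h] column_zeros_design_array[OF T e h] eq by simp
      then show ?thesis
        using resolvable_design_replicate(3)[OF T d h] resolvable_design_replicate(3)[OF T e h]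
        by simp
    qed
    then show "d = e"
      using d e unfolding resolvable_designs_def by (intro PiE_ext)
  qed
  show "design_array T r ` ?D = ?A"
  proof (intro equalityI subsetI)
    fix X assume "X \<in> design_array T r ` ?D"
    then show "X \<in> ?A"
      using design_array_binary column_zeros_design_array[OF T]
        resolvable_design_replicate(2)[OF T] by fastforce
  next
    fix X assume A: "X \<in> ?A"
    then have X: "X \<in> binary_arrays T r" by blast
    define d where "d = (\<lambda>h\<in>{1..r}. (column_zeros T X h, T - column_zeros T X h))"
    have d: "d \<in> ?D"
      using A column_zeros_subset[of T X]
      unfolding resolvable_designs_def replicates_eq[OF T] d_def by auto
    have "design_array T r d = X"
    proof (rule PiE_ext)
      show "design_array T r d \<in> T \<rightarrow>\<^sub>E ({1..r} \<rightarrow>\<^sub>E {0, 1})" "X \<in> T \<rightarrow>\<^sub>E ({1..r} \<rightarrow>\<^sub>E {0, 1})"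
        using design_array_binary[of T r d] X unfolding binary_arrays_def .
      fix i assume i: "i \<in> T"
      show "design_array T r d i = X i"
      proof (rule PiE_ext)
        show "design_array T r d i \<in> {1..r} \<rightarrow>\<^sub>E {0, 1}" "X i \<in> {1..r} \<rightarrow>\<^sub>E {0, 1}"
          using design_array_binary[of T r d] X i unfolding binary_arrays_def by (blast dest: PiE_mem)+
        fix h assume h: "h \<in> {1..r}"
        show "design_array T r d i h = X i h"
          using binary_array_entry[OF X i h] i h
          by (auto simp: design_array_def d_def column_zeros_def)
      qed
    qed
    then show "X \<in> design_array T r ` ?D"
      using d by blast
  qed
qed

theorem theorem24:
  fixes T :: "'a set" and v k1 k2 r \<theta> :: nat
  assumes "k1 \<ge> k2" and "k2 \<ge> 2"
    and "v = k1 + k2"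
    and "2 \<le> r" and "r \<le> v - 1"
    and "finite T" and "card T = v"
  shows "(\<forall>d\<in>resolvable_designs T k1 k2 r.
            equal_concurrence r \<theta> d \<longleftrightarrow> balanced_array T k1 r \<theta> (design_array T r d)) \<and>
         bij_betw (design_array T r)
           {d \<in> resolvable_designs T k1 k2 r. equal_concurrence r \<theta> d}
           {X. balanced_array T k1 r \<theta> X}"
proof -
  let ?D = "resolvable_designs T k1 k2 r"
  let ?A = "{X \<in> binary_arrays T r. \<forall>h\<in>{1..r}. card (column_zeros T X h) = k1}"
  have T: "finite T" "card T = k1 + k2"
    using assms by auto
  have bij: "bij_betw (design_array T r) ?D ?A"
    by (rule bij_betw_design_array[OF T])
  have iff: "equal_concurrence r \<theta> d \<longleftrightarrow> balanced_array T k1 r \<theta> (design_array T r d)"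
    if d: "d \<in> ?D" for d
  proof -
    have "design_array T r d \<in> ?A"
      using bij d by (rule bij_betwE[THEN bspec])
    then show ?thesis
      using pair_frequency_design_array[OF T d]
      by (simp add: balanced_array_iff[OF T(1)] equal_concurrence_def)
  qed
  have "bij_betw (design_array T r) {d \<in> ?D. equal_concurrence r \<theta> d}
      {X \<in> ?A. balanced_array T k1 r \<theta> X}"
    using bij iff by (intro bij_betw_Collect) auto
  also have "{X \<in> ?A. balanced_array T k1 r \<theta> X} = {X. balanced_array T k1 r \<theta> X}"
    by (auto simp: balanced_array_iff[OF T(1)])
  finally show ?thesis using iff by simp
qed

end
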